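(* Let $N\in\{3,4\}$ and let $|C_N\rangle$ be the $N$-qubit linear cluster state $$|C_N\rangle=\frac{1}{\sqrt{2^N}}\sum_{(s_1,\dots,s_N)\in\{0,1\}^N}(-1)^{\sum_{i=1}^{N-1}s_is_{i+1}}|s_1s_2\cdots s_N\rangle.$$ For the local beam-splitter broadcasting protocol with input $|C_N\rangle$ and copy fidelities $\mathcal{F}_1^{(N)}(R)$ (transmitted) and $\mathcal{F}_2^{(N)}(R)$ (reflected), there is no $R\in(0,1)$ for which both $\mathcal{F}_1^{(N)}(R)>\tfrac12$ and $\mathcal{F}_2^{(N)}(R)>\tfrac12$.
   Context: Local beam-splitter broadcasting protocol with reflectivity $R\in[0,1]$. Let $|\Phi_N\rangle$ be an $N$-qubit unit vector on qubits $1,\dots,N$. For each $j=1,\dots,N$ take an ancillary pair of qubits $a_j,b_j$ in the state $|\chi_j\rangle_{a_jb_j}=\frac{1}{\sqrt2}(|01\rangle-|10\rangle)$. The initial state on $3N$ qubits is $|\Psi_{\rm in}\rangle=|\Phi_N\rangle_{1\dots N}\otimes\bigotimes_{j=1}^N|\chi_j\rangle_{a_jb_j}$. Let $S_{j,a_j}$ be the swap operator exchanging qubits $j$ and $a_j$, and let $U_j=(1-R)\,\mathbf{1}-R\,S_{j,a_j}$. The unnormalised output is $|\Psi_{\rm out}\rangle=\left(\prod_{j=1}^N U_j\right)|\Psi_{\rm in}\rangle$. Let $\rho_1$ be the partial trace of $|\Psi_{\rm out}\rangle\langle\Psi_{\rm out}|$ over all qubits $a_j,b_j$ (so it acts on qubits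 $1,\dots,N$), and let $\rho_2$ be its partial trace over qubits $1,\dots,N$ and all $a_j$ (so it acts on qubits $b_1,\dots,b_N$). The copy fidelities for the input $|\Phi_N\rangle$ are $$\mathcal{F}_1^{(N)}=\frac{\langle\Phi_N|\rho_1|\Phi_N\rangle}{\langle\Psi_{\rm out}|\Psi_{\rm out}\rangle},\qquad \mathcal{F}_2^{(N)}=\frac{\langle\Phi_N|\rho_2|\Phi_N\rangle}{\langle\Psi_{\rm out}|\Psi_{\rm out}\rangle}.$$ *)

theory Defs
  imports Complex_Main
begin

text \<open>
  Computational basis labels of an N-qubit register are bit strings of length N
  (False for 0, True for 1); list position j (counted from 0) is qubit j + 1.
  A vector is given by its amplitudes, an operator by its matrix entries; only their values on
  labels of the right length are ever used.
\<close>

type_synonym bits = "bool list"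
type_synonym 'x ket = "'x \<Rightarrow> complex"
type_synonym 'x operator = "'x \<Rightarrow> 'x \<Rightarrow> complex"

definition bitstrings :: "nat \<Rightarrow> bits set" where
  "bitstrings N = {s. length s = N}"

definition braket :: "'x set \<Rightarrow> 'x ket \<Rightarrow> 'x ket \<Rightarrow> complex" where
  "braket X \<phi> \<psi> = (\<Sum>x\<in>X. cnj (\<phi> x) * \<psi> x)"

definition ketbra :: "'x ket \<Rightarrow> 'x operator" where
  "ketbra \<psi> x y = \<psi> x * cnj (\<psi> y)"

definition op_apply :: "'x set \<Rightarrow> 'x operator \<Rightarrow> 'x ket \<Rightarrow> 'x ket" where
  "op_apply X M \<psi> x = (\<Sum>y\<in>X. M x y * \<psi> y)"

text \<open>
  The 3N qubits are grouped into three registers: a basis label (s, a, b) lists the values of the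
  qubits 1, ..., N, of the qubits a_1, ..., a_N and of the qubits b_1, ..., b_N.
\<close>

type_synonym bits3 = "bits \<times> bits \<times> bits"

definition bitstrings3 :: "nat \<Rightarrow> bits3 set" where
  "bitstrings3 N = bitstrings N \<times> bitstrings N \<times> bitstrings N"

definition singlet :: "bool \<Rightarrow> bool \<Rightarrow> complex" where
  "singlet x y = (of_bool (\<not> x \<and> y) - of_bool (x \<and> \<not> y)) / complex_of_real (sqrt 2)"

definition psi_in :: "nat \<Rightarrow> bits ket \<Rightarrow> bits3 ket" where
  "psi_in N \<Phi> = (\<lambda>(s, a, b). \<Phi> s * (\<Prod>j<N. singlet (a ! j) (b ! j)))"

definition swap_op :: "nat \<Rightarrow> bits3 ket \<Rightarrow> bits3 ket" where
  "swap_op j \<Psi> = (\<lambda>(s, a, b). \<Psi> (s[j := a ! j], a[j := s ! j], b))"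

definition bs_op :: "real \<Rightarrow> nat \<Rightarrow> bits3 ket \<Rightarrow> bits3 ket" where
  "bs_op R j \<Psi> = (\<lambda>x. complex_of_real (1 - R) * \<Psi> x - complex_of_real R * swap_op j \<Psi> x)"

text \<open>The operators for different j commute, so the order in which they are applied is immaterial.\<close>

definition psi_out :: "nat \<Rightarrow> real \<Rightarrow> bits ket \<Rightarrow> bits3 ket" where
  "psi_out N R \<Phi> = fold (bs_op R) [0..<N] (psi_in N \<Phi>)"

definition ptrace_ab :: "nat \<Rightarrow> bits3 operator \<Rightarrow> bits operator" where
  "ptrace_ab N M s s' = (\<Sum>a\<in>bitstrings N. \<Sum>b\<in>bitstrings N. M (s, a, b) (s', a, b))"

definition ptrace_sa :: "nat \<Rightarrow> bits3 operator \<Rightarrow> bits operator" where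
  "ptrace_sa N M b b' = (\<Sum>s\<in>bitstrings N. \<Sum>a\<in>bitstrings N. M (s, a, b) (s, a, b'))"

definition rho1 :: "nat \<Rightarrow> real \<Rightarrow> bits ket \<Rightarrow> bits operator" where
  "rho1 N R \<Phi> = ptrace_ab N (ketbra (psi_out N R \<Phi>))"

definition rho2 :: "nat \<Rightarrow> real \<Rightarrow> bits ket \<Rightarrow> bits operator" where
  "rho2 N R \<Phi> = ptrace_sa N (ketbra (psi_out N R \<Phi>))"

text \<open>
  Both quotients below are real numbers, since the reduced operators are Hermitian; taking the real
  part only changes the type.
\<close>

definition fidelity1 :: "nat \<Rightarrow> bits ket \<Rightarrow> real \<Rightarrow> real" where
  "fidelity1 N \<Phi> R =
     Re (braket (bitstrings N) \<Phi> (op_apply (bitstrings N) (rho1 N R \<Phi>) \<Phi>) /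
         braket (bitstrings3 N) (psi_out N R \<Phi>) (psi_out N R \<Phi>))"

definition fidelity2 :: "nat \<Rightarrow> bits ket \<Rightarrow> real \<Rightarrow> real" where
  "fidelity2 N \<Phi> R =
     Re (braket (bitstrings N) \<Phi> (op_apply (bitstrings N) (rho2 N R \<Phi>) \<Phi>) /
         braket (bitstrings3 N) (psi_out N R \<Phi>) (psi_out N R \<Phi>))"

definition cluster_state :: "nat \<Rightarrow> bits ket" where
  "cluster_state N s =
     (- 1) ^ (\<Sum>i<N - 1. of_bool (s ! i) * of_bool (s ! Suc i)) / complex_of_real (sqrt (2 ^ N))"

end

theory Submission
  imports Defs
begin

text \<open>
  Tracing out the other registers turns the protocol into a product of single-qubit maps, which
  multiply traceless operators by \<open>\<alpha>\<close> and the identity by \<open>D = 1 - 3 * R + 3 * R\<^sup>2\<close>,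
  with \<open>\<alpha> = (1 - R) * (1 - 2 * R)\<close> for the transmitted and \<open>\<alpha> = R * (1 - R)\<close> for the reflected
  copy. With \<open>\<lambda> = \<alpha> / D\<close>, the fidelity is therefore the weight enumerator of the stabiliser group of
  the cluster state, namely \<open>(1 + 3 * \<lambda>\<^sup>2 + 4 * \<lambda>^3) / 8\<close> for three qubits and
  \<open>(1 + 2 * \<lambda>\<^sup>2 + 8 * \<lambda>^3 + 5 * \<lambda>^4) / 16\<close> for four. As \<open>\<lambda> \<ge> - 1\<close> throughout, either
  exceeds 1/2 only if \<open>\<lambda> > 2 / 3\<close>. For the transmitted copy this forces \<open>R < 1 / 3\<close>, for the reflected one \<open>R > 1 / 3\<close>.
\<close>

section \<open>Sums over bit strings\<close>

lemma finite_bitstrings [simp]: "finite (bitstrings n)"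
  unfolding bitstrings_def using finite_lists_length_eq[of "UNIV :: bool set" n] by simp

lemma bitstrings_0: "bitstrings 0 = {[]}"
  by (auto simp: bitstrings_def)

lemma sum_bitstrings_Suc:
  fixes f :: "bits \<Rightarrow> 'a::comm_monoid_add"
  shows "(\<Sum>s\<in>bitstrings (Suc n). f s) = (\<Sum>x\<in>UNIV. \<Sum>s\<in>bitstrings n. f (x # s))"
proof -
  have "bitstrings (Suc n) = (\<lambda>(x, s). x # s) ` (UNIV \<times> bitstrings n)"
    by (auto simp: bitstrings_def length_Suc_conv image_iff)
  moreover have "inj_on (\<lambda>(x, s). x # s) (UNIV \<times> bitstrings n)"
    by (auto simp: inj_on_def)
  ultimately show ?thesis
    by (simp add: sum.reindex sum.cartesian_product case_prod_unfold)
qed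

text \<open>Distributivity, by peeling off the first bit. All later traces factor over the sites
  because of this.\<close>

lemma sum_bitstrings_prod:
  fixes f :: "nat \<Rightarrow> bool \<Rightarrow> 'a::comm_semiring_1"
  shows "(\<Sum>s\<in>bitstrings n. \<Prod>j<n. f j (s ! j)) = (\<Prod>j<n. \<Sum>x\<in>UNIV. f j x)"
proof (induction n arbitrary: f)
  case 0
  show ?case by (simp add: bitstrings_0)
next
  case (Suc n)
  have "(\<Sum>s\<in>bitstrings (Suc n). \<Prod>j<Suc n. f j (s ! j))
      = (\<Sum>x\<in>UNIV. f 0 x * (\<Sum>s\<in>bitstrings n. \<Prod>j<n. f (Suc j) (s ! j)))"
    unfolding sum_bitstrings_Suc by (simp add: prod.lessThan_Suc_shift sum_distrib_left del: prod.lessThan_Suc)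
  also have "\<dots> = (\<Prod>j<Suc n. \<Sum>x\<in>UNIV. f j x)"
    unfolding Suc.IH[of "\<lambda>j. f (Suc j)"]
    by (simp only: prod.lessThan_Suc_shift sum_distrib_right)
  finally show ?case .
qed

lemma prod_of_bool_bits_eq:
  assumes "s \<in> bitstrings n" "u \<in> bitstrings n"
  shows "(\<Prod>j<n. of_bool (s ! j = u ! j) :: 'a::comm_semiring_1) = of_bool (s = u)"
proof (cases "s = u")
  case False
  then obtain j where "j < n" "s ! j \<noteq> u ! j"
    using assms by (auto simp: bitstrings_def list_eq_iff_nth_eq)
  then have "(\<Prod>j<n. of_bool (s ! j = u ! j) :: 'a) = 0"
    by (intro prod_zero) auto
  then show ?thesis using False by simp
qed simp

section \<open>The output state and its reductions\<close>

text \<open>Matrix entry, at one site, of the map adjoining a singlet to the basis state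
  \<open>u\<close>. By linearity the protocol is an N-fold product of such maps.\<close>

definition input_kernel :: "bool \<Rightarrow> bool \<Rightarrow> bool \<Rightarrow> bool \<Rightarrow> complex" where
  "input_kernel s a b u = of_bool (s = u) * singlet a b"

definition output_kernel :: "real \<Rightarrow> bool \<Rightarrow> bool \<Rightarrow> bool \<Rightarrow> bool \<Rightarrow> complex" where
  "output_kernel R s a b u =
     complex_of_real (1 - R) * input_kernel s a b u - complex_of_real R * input_kernel a s b u"

lemma psi_in_eq_sum_prod:
  assumes "s \<in> bitstrings N"
  shows "psi_in N \<Phi> (s, a, b) =
    (\<Sum>u\<in>bitstrings N. \<Phi> u * (\<Prod>j<N. input_kernel (s ! j) (a ! j) (b ! j) (u ! j)))"
proof -
  have "(\<Sum>u\<in>bitstrings N. \<Phi> u * (\<Prod>j<N. input_kernel (s ! j) (a ! j) (b ! j) (u ! j)))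
      = (\<Sum>u\<in>bitstrings N. if s = u then \<Phi> u * (\<Prod>j<N. singlet (a ! j) (b ! j)) else 0)"
    using assms
    by (intro sum.cong refl) (auto simp: input_kernel_def prod.distrib prod_of_bool_bits_eq)
  then show ?thesis using assms by (simp add: psi_in_def)
qed

text \<open>Induction invariant: after \<open>n\<close> beam splitters exactly the sites below
  \<open>n\<close> carry the output kernel. The labels \<open>s\<close> and \<open>a\<close> must
  vary, since a swap evaluates the state at exchanged labels.\<close>

lemma fold_bs_op_psi_in:
  assumes "n \<le> N" "s \<in> bitstrings N" "a \<in> bitstrings N"
  shows "fold (bs_op R) [0..<n] (psi_in N \<Phi>) (s, a, b) =
    (\<Sum>u\<in>bitstrings N. \<Phi> u * (\<Prod>j<N. (if j < n then output_kernel R else input_kernel)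
       (s ! j) (a ! j) (b ! j) (u ! j)))"
  using assms
proof (induction n arbitrary: s a)
  case 0
  then show ?case by (simp add: psi_in_eq_sum_prod)
next
  case (Suc n)
  \<comment> \<open>The factors of all sites but \<open>n\<close>; the swap at \<open>n\<close>
    leaves them alone, so both terms of the beam splitter share them.\<close>
  define rest where "rest u = (\<Prod>j\<in>{..<N} - {n}. (if j < n then output_kernel R else input_kernel)
       (s ! j) (a ! j) (b ! j) (u ! j))" for u
  have n: "n < N" and len: "length s = N" "length a = N"
    using Suc.prems by (auto simp: bitstrings_def)
  have split: "(\<Prod>j<N. f j) = f n * (\<Prod>j\<in>{..<N} - {n}. f j)" for f :: "nat \<Rightarrow> complex"
    using n by (intro prod.remove) auto
  have unswapped: "fold (bs_op R) [0..<n] (psi_in N \<Phi>) (s, a, b) =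
      (\<Sum>u\<in>bitstrings N. \<Phi> u * (input_kernel (s ! n) (a ! n) (b ! n) (u ! n) * rest u))"
    using Suc.prems by (subst Suc.IH) (simp_all add: split rest_def)
  have "fold (bs_op R) [0..<n] (psi_in N \<Phi>) (s[n := a ! n], a[n := s ! n], b) =
      (\<Sum>u\<in>bitstrings N. \<Phi> u * (input_kernel (a ! n) (s ! n) (b ! n) (u ! n) *
        (\<Prod>j\<in>{..<N} - {n}. (if j < n then output_kernel R else input_kernel)
          (s[n := a ! n] ! j) (a[n := s ! n] ! j) (b ! j) (u ! j))))"
    using Suc.prems n by (subst Suc.IH) (simp_all add: split bitstrings_def)
  also have "\<dots> = (\<Sum>u\<in>bitstrings N. \<Phi> u * (input_kernel (a ! n) (s ! n) (b ! n) (u ! n) * rest u))"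
    unfolding rest_def by (intro sum.cong arg_cong2[of _ _ _ _ "(*)"] prod.cong refl) auto
  finally have swapped: "fold (bs_op R) [0..<n] (psi_in N \<Phi>) (s[n := a ! n], a[n := s ! n], b) = \<dots>" .
  have "fold (bs_op R) [0..<Suc n] (psi_in N \<Phi>) (s, a, b) =
      (\<Sum>u\<in>bitstrings N. \<Phi> u * (output_kernel R (s ! n) (a ! n) (b ! n) (u ! n) * rest u))"
    unfolding output_kernel_def
    by (simp add: bs_op_def swap_op_def unswapped swapped sum_distrib_left left_diff_distrib
        right_diff_distrib sum_subtractf mult_ac)
  also have "\<dots> = (\<Sum>u\<in>bitstrings N. \<Phi> u * (\<Prod>j<N. (if j < Suc n then output_kernel R else input_kernel)
       (s ! j) (a ! j) (b ! j) (u ! j)))"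
    unfolding split rest_def
    by (intro sum.cong arg_cong2[of _ _ _ _ "(*)"] prod.cong refl) auto
  finally show ?case .
qed

lemma psi_out_eq_sum_prod:
  assumes "s \<in> bitstrings N" "a \<in> bitstrings N"
  shows "psi_out N R \<Phi> (s, a, b) =
    (\<Sum>u\<in>bitstrings N. \<Phi> u * (\<Prod>j<N. output_kernel R (s ! j) (a ! j) (b ! j) (u ! j)))"
  unfolding psi_out_def fold_bs_op_psi_in[OF order.refl assms]
  by (intro sum.cong arg_cong2[of _ _ _ _ "(*)"] prod.cong refl) auto

text \<open>Moving the sums over the input labels outside leaves a trace of a product over sites,
  which factors. The kernel \<open>f\<close> is arbitrary so that either copy can be the register
  kept.\<close>

lemma partial_trace_product_kernel:
  fixes f :: "bool \<Rightarrow> bool \<Rightarrow> bool \<Rightarrow> bool \<Rightarrow> complex"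
  shows "(\<Sum>a\<in>bitstrings N. \<Sum>b\<in>bitstrings N.
      (\<Sum>u\<in>bitstrings N. \<Phi> u * (\<Prod>j<N. f (x ! j) (a ! j) (b ! j) (u ! j))) *
      cnj (\<Sum>u\<in>bitstrings N. \<Phi> u * (\<Prod>j<N. f (y ! j) (a ! j) (b ! j) (u ! j)))) =
    (\<Sum>u\<in>bitstrings N. \<Sum>v\<in>bitstrings N. \<Phi> u * cnj (\<Phi> v) *
      (\<Prod>j<N. \<Sum>a\<in>UNIV. \<Sum>b\<in>UNIV. f (x ! j) a b (u ! j) * cnj (f (y ! j) a b (v ! j))))"
    (is "?L = ?R")
proof -
  define g where "g u v a b = (\<Prod>j<N. f (x ! j) (a ! j) (b ! j) (u ! j) *
    cnj (f (y ! j) (a ! j) (b ! j) (v ! j)))" for u v a b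
  have "?L = (\<Sum>a\<in>bitstrings N. \<Sum>b\<in>bitstrings N. \<Sum>u\<in>bitstrings N. \<Sum>v\<in>bitstrings N.
      \<Phi> u * cnj (\<Phi> v) * g u v a b)"
    by (simp add: sum_product g_def prod.distrib mult_ac)
  also have "\<dots> = (\<Sum>a\<in>bitstrings N. \<Sum>u\<in>bitstrings N. \<Sum>b\<in>bitstrings N. \<Sum>v\<in>bitstrings N.
      \<Phi> u * cnj (\<Phi> v) * g u v a b)"
    by (intro sum.cong refl sum.swap)
  also have "\<dots> = (\<Sum>u\<in>bitstrings N. \<Sum>a\<in>bitstrings N. \<Sum>b\<in>bitstrings N. \<Sum>v\<in>bitstrings N.
      \<Phi> u * cnj (\<Phi> v) * g u v a b)"
    by (rule sum.swap)
  also have "\<dots> = (\<Sum>u\<in>bitstrings N. \<Sum>a\<in>bitstrings N. \<Sum>v\<in>bitstrings N. \<Sum>b\<in>bitstrings N.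
      \<Phi> u * cnj (\<Phi> v) * g u v a b)"
    by (intro sum.cong refl sum.swap)
  also have "\<dots> = (\<Sum>u\<in>bitstrings N. \<Sum>v\<in>bitstrings N. \<Sum>a\<in>bitstrings N. \<Sum>b\<in>bitstrings N.
      \<Phi> u * cnj (\<Phi> v) * g u v a b)"
    by (intro sum.cong refl sum.swap)
  also have "\<dots> = ?R"
  proof (intro sum.cong refl)
    fix u v
    have "(\<Sum>a\<in>bitstrings N. \<Sum>b\<in>bitstrings N. g u v a b) = (\<Sum>a\<in>bitstrings N. \<Prod>j<N. \<Sum>b\<in>UNIV.
        f (x ! j) (a ! j) b (u ! j) * cnj (f (y ! j) (a ! j) b (v ! j)))"
      unfolding g_def
      by (intro sum.cong refl) (rule sum_bitstrings_prod)
    also have "\<dots> = (\<Prod>j<N. \<Sum>a\<in>UNIV. \<Sum>b\<in>UNIV. f (x ! j) a b (u ! j) * cnj (f (y ! j) a b (v ! j)))"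
      by (rule sum_bitstrings_prod)
    finally show "(\<Sum>a\<in>bitstrings N. \<Sum>b\<in>bitstrings N. \<Phi> u * cnj (\<Phi> v) * g u v a b) =
        \<Phi> u * cnj (\<Phi> v) * (\<Prod>j<N. \<Sum>a\<in>UNIV. \<Sum>b\<in>UNIV.
          f (x ! j) a b (u ! j) * cnj (f (y ! j) a b (v ! j)))"
      by (simp flip: sum_distrib_left)
  qed
  finally show ?thesis .
qed

section \<open>Single-qubit reduced maps\<close>

text \<open>Matrix entries of the map \<open>X \<mapsto> \<alpha> * X + \<beta> * trace X * 1\<close> on a single qubit.\<close>

definition depolarise :: "complex \<Rightarrow> complex \<Rightarrow> bool \<Rightarrow> bool \<Rightarrow> bool \<Rightarrow> bool \<Rightarrow> complex" where
  "depolarise \<alpha> \<beta> x y u v =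
     \<alpha> * of_bool (x = u \<and> y = v) + \<beta> * of_bool (x = y \<and> u = v)"

lemma singlet_simps:
  "singlet False False = 0" "singlet True True = 0"
  "singlet False True = 1 / complex_of_real (sqrt 2)"
  "singlet True False = - 1 / complex_of_real (sqrt 2)"
  by (simp_all add: singlet_def)

lemma complex_sqrt_2_mult [simp]: "complex_of_real (sqrt 2) * complex_of_real (sqrt 2) = 2"
  by (simp flip: of_real_mult)

text \<open>The direct term gives \<open>(1 - R)\<^sup>2 * X\<close>, the two cross terms together
  \<open>- R * (1 - R) * X\<close>, and the swapped term leaves half a singlet, hence a maximally
  mixed qubit with weight \<open>R\<^sup>2\<close>.\<close>

lemma transmitted_kernel:
  "(\<Sum>a\<in>UNIV. \<Sum>b\<in>UNIV. output_kernel R x a b u * cnj (output_kernel R y a b v)) =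
    depolarise (of_real ((1 - R) * (1 - 2 * R))) (of_real (R\<^sup>2 / 2)) x y u v"
  by (cases x; cases y; cases u; cases v)
    (simp_all add: UNIV_bool output_kernel_def input_kernel_def singlet_simps depolarise_def
      field_simps power2_eq_square)

text \<open>Direct and swapped terms both leave a maximally mixed qubit; the cross terms contribute
  \<open>R * (1 - R) * (X - trace X * 1)\<close>.\<close>

lemma reflected_kernel:
  "(\<Sum>s\<in>UNIV. \<Sum>a\<in>UNIV. output_kernel R s a x u * cnj (output_kernel R s a y v)) =
    depolarise (of_real (R * (1 - R))) (of_real ((1 - 2 * R)\<^sup>2 / 2)) x y u v"
  by (cases x; cases y; cases u; cases v)
    (simp_all add: UNIV_bool output_kernel_def input_kernel_def singlet_simps depolarise_def
      field_simps power2_eq_square)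

section \<open>Reduced states and normalisation\<close>

definition depolarised_state ::
    "nat \<Rightarrow> complex \<Rightarrow> complex \<Rightarrow> bits ket \<Rightarrow> bits operator" where
  "depolarised_state N \<alpha> \<beta> \<Phi> x y = (\<Sum>u\<in>bitstrings N. \<Sum>v\<in>bitstrings N. \<Phi> u * cnj (\<Phi> v) *
     (\<Prod>j<N. depolarise \<alpha> \<beta> (x ! j) (y ! j) (u ! j) (v ! j)))"

lemma rho1_eq_depolarised_state:
  assumes "x \<in> bitstrings N" "y \<in> bitstrings N"
  shows "rho1 N R \<Phi> x y =
    depolarised_state N (of_real ((1 - R) * (1 - 2 * R))) (of_real (R\<^sup>2 / 2)) \<Phi> x y"
  unfolding rho1_def ptrace_ab_def ketbra_def depolarised_state_def transmitted_kernel[symmetric]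
    partial_trace_product_kernel[symmetric]
  using assms by (intro sum.cong refl) (simp only: psi_out_eq_sum_prod)

lemma rho2_eq_depolarised_state:
  "rho2 N R \<Phi> x y =
    depolarised_state N (of_real (R * (1 - R))) (of_real ((1 - 2 * R)\<^sup>2 / 2)) \<Phi> x y"
proof -
  have "rho2 N R \<Phi> x y = (\<Sum>s\<in>bitstrings N. \<Sum>a\<in>bitstrings N.
      (\<Sum>u\<in>bitstrings N. \<Phi> u * (\<Prod>j<N. output_kernel R (s ! j) (a ! j) (x ! j) (u ! j))) *
      cnj (\<Sum>u\<in>bitstrings N. \<Phi> u * (\<Prod>j<N. output_kernel R (s ! j) (a ! j) (y ! j) (u ! j))))"
    unfolding rho2_def ptrace_sa_def ketbra_def
    by (intro sum.cong refl) (simp only: psi_out_eq_sum_prod)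
  also have "\<dots> = depolarised_state N (of_real (R * (1 - R))) (of_real ((1 - 2 * R)\<^sup>2 / 2)) \<Phi> x y"
    unfolding depolarised_state_def reflected_kernel[symmetric]
    \<comment> \<open>The kept register is now b, so the kernel arguments are permuted to put it
      first.\<close>
    by (rule partial_trace_product_kernel[where f = "\<lambda>x s a u. output_kernel R s a x u"])
  finally show ?thesis .
qed

text \<open>Each single-qubit map multiplies the trace by
  \<open>\<alpha> + 2 * \<beta>\<close>.\<close>

lemma trace_depolarised_state:
  "(\<Sum>s\<in>bitstrings N. depolarised_state N \<alpha> \<beta> \<Phi> s s) =
    (\<alpha> + 2 * \<beta>) ^ N * braket (bitstrings N) \<Phi> \<Phi>"
proof -
  have single: "(\<Sum>x\<in>UNIV. depolarise \<alpha> \<beta> x x u v) = (\<alpha> + 2 * \<beta>) * of_bool (u = v)" for u v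
    by (cases u; cases v) (simp_all add: UNIV_bool depolarise_def)
  have "(\<Sum>s\<in>bitstrings N. depolarised_state N \<alpha> \<beta> \<Phi> s s) =
      (\<Sum>u\<in>bitstrings N. \<Sum>s\<in>bitstrings N. \<Sum>v\<in>bitstrings N. \<Phi> u * cnj (\<Phi> v) *
        (\<Prod>j<N. depolarise \<alpha> \<beta> (s ! j) (s ! j) (u ! j) (v ! j)))"
    unfolding depolarised_state_def by (rule sum.swap)
  also have "\<dots> = (\<Sum>u\<in>bitstrings N. \<Sum>v\<in>bitstrings N. \<Sum>s\<in>bitstrings N. \<Phi> u * cnj (\<Phi> v) *
        (\<Prod>j<N. depolarise \<alpha> \<beta> (s ! j) (s ! j) (u ! j) (v ! j)))"
    by (intro sum.cong refl sum.swap)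
  also have "\<dots> = (\<Sum>u\<in>bitstrings N. \<Sum>v\<in>bitstrings N. \<Phi> u * cnj (\<Phi> v) *
        (\<Prod>j<N. \<Sum>x\<in>UNIV. depolarise \<alpha> \<beta> x x (u ! j) (v ! j)))"
    unfolding sum_distrib_left[symmetric]
    by (intro sum.cong arg_cong2[of _ _ _ _ "(*)"] refl) (rule sum_bitstrings_prod)
  also have "\<dots> = (\<Sum>u\<in>bitstrings N. \<Sum>v\<in>bitstrings N.
        if u = v then (\<alpha> + 2 * \<beta>) ^ N * (cnj (\<Phi> u) * \<Phi> u) else 0)"
    by (intro sum.cong refl) (simp add: single prod.distrib prod_of_bool_bits_eq)
  also have "\<dots> = (\<alpha> + 2 * \<beta>) ^ N * braket (bitstrings N) \<Phi> \<Phi>"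
    by (simp add: braket_def sum_distrib_left)
  finally show ?thesis .
qed

text \<open>The squared norm is the trace of the transmitted reduced state, for which
  \<open>\<alpha> + 2 * \<beta>\<close> is \<open>1 - 3 * R + 3 * R\<^sup>2\<close>.\<close>

lemma norm_psi_out:
  "braket (bitstrings3 N) (psi_out N R \<Phi>) (psi_out N R \<Phi>) =
    of_real ((1 - 3 * R + 3 * R\<^sup>2) ^ N) * braket (bitstrings N) \<Phi> \<Phi>"
proof -
  have "braket (bitstrings3 N) (psi_out N R \<Phi>) (psi_out N R \<Phi>) =
      (\<Sum>s\<in>bitstrings N. rho1 N R \<Phi> s s)"
    by (simp add: braket_def bitstrings3_def rho1_def ptrace_ab_def ketbra_def mult.commute
        sum.cartesian_product')
  also have "\<dots> = (\<Sum>s\<in>bitstrings N.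
      depolarised_state N (of_real ((1 - R) * (1 - 2 * R))) (of_real (R\<^sup>2 / 2)) \<Phi> s s)"
    by (simp add: rho1_eq_depolarised_state)
  also have "\<dots> = of_real ((1 - 3 * R + 3 * R\<^sup>2) ^ N) * braket (bitstrings N) \<Phi> \<Phi>"
    by (simp add: trace_depolarised_state algebra_simps power2_eq_square)
  finally show ?thesis .
qed

section \<open>The cluster state\<close>

text \<open>\<open>cluster_sign t s\<close> is the sign of the basis label \<open>s\<close> when it is preceded by a qubit with value \<open>t\<close>.\<close>

primrec cluster_sign :: "bool \<Rightarrow> bits \<Rightarrow> complex" where
  "cluster_sign t [] = 1"
| "cluster_sign t (x # s) = (if t \<and> x then - 1 else 1) * cluster_sign x s"

lemma cluster_sign_eq:
  "(- 1) ^ (\<Sum>i<length s. of_bool ((x # s) ! i) * of_bool (s ! i)) = cluster_sign x s"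
  by (induction s arbitrary: x) (simp_all add: sum.lessThan_Suc_shift power_add del: sum.lessThan_Suc)

text \<open>A fictitious preceding qubit with value 0 adds no sign, so the recursion may start at
  \<open>False\<close>.\<close>

lemma cluster_state_eq:
  assumes "s \<in> bitstrings N"
  shows "cluster_state N s = cluster_sign False s / complex_of_real (sqrt (2 ^ N))"
proof (cases s)
  case (Cons x s')
  then show ?thesis
    using assms cluster_sign_eq[where x = x and s = s'] by (auto simp: cluster_state_def bitstrings_def)
qed (use assms in \<open>auto simp: cluster_state_def bitstrings_def\<close>)

lemma cnj_cluster_sign [simp]: "cnj (cluster_sign t s) = cluster_sign t s"
  by (induction s arbitrary: t) auto

lemma cluster_sign_square: "cluster_sign t s * cluster_sign t s = 1"
  by (induction s arbitrary: t) (auto simp: algebra_simps)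

lemma card_bitstrings: "card (bitstrings n) = 2 ^ n"
  unfolding bitstrings_def using card_lists_length_eq[of "UNIV :: bool set" n] by simp

lemma complex_sqrt_power_2_mult:
  "complex_of_real (sqrt (2 ^ N)) * complex_of_real (sqrt (2 ^ N)) = 2 ^ N"
  by (simp flip: of_real_mult)

lemma norm_cluster_state: "braket (bitstrings N) (cluster_state N) (cluster_state N) = 1"
  by (simp add: braket_def cluster_state_eq cluster_sign_square complex_sqrt_power_2_mult
      card_bitstrings)

text \<open>Partition function of a chain with four bits per site, to be evaluated by a transfer
  matrix; \<open>p\<close>, \<open>q\<close>, \<open>r\<close>, \<open>t\<close> are the bits of the
  site before the first.\<close>

definition chain_sum :: "complex \<Rightarrow> complex \<Rightarrow> nat \<Rightarrow> bool \<Rightarrow> bool \<Rightarrow> bool \<Rightarrow> bool \<Rightarrow> complex" where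
  "chain_sum \<alpha> \<beta> n p q r t =
    (\<Sum>x\<in>bitstrings n. \<Sum>y\<in>bitstrings n. \<Sum>u\<in>bitstrings n. \<Sum>v\<in>bitstrings n.
      cluster_sign p x * cluster_sign q y * cluster_sign r u * cluster_sign t v *
      (\<Prod>j<n. depolarise \<alpha> \<beta> (x ! j) (y ! j) (u ! j) (v ! j)))"

lemma fidelity_numerator_cluster:
  assumes "\<And>x y. x \<in> bitstrings N \<Longrightarrow> y \<in> bitstrings N \<Longrightarrow>
    \<rho> x y = depolarised_state N \<alpha> \<beta> (cluster_state N) x y"
  shows "braket (bitstrings N) (cluster_state N) (op_apply (bitstrings N) \<rho> (cluster_state N)) =
    chain_sum \<alpha> \<beta> N False False False False / 4 ^ N"
proof -
  \<comment> \<open>Four real cluster amplitudes meet in each summand, each with denominator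
    \<open>c\<close>.\<close>
  define c where "c = complex_of_real (sqrt (2 ^ N))"
  have c: "c * c * (c * c) = 4 ^ N"
    unfolding c_def complex_sqrt_power_2_mult by (simp flip: power_mult_distrib)
  have "braket (bitstrings N) (cluster_state N) (op_apply (bitstrings N) \<rho> (cluster_state N)) =
    (\<Sum>x\<in>bitstrings N. \<Sum>y\<in>bitstrings N. \<Sum>u\<in>bitstrings N. \<Sum>v\<in>bitstrings N.
      cluster_sign False x * cluster_sign False y * cluster_sign False u * cluster_sign False v *
      (\<Prod>j<N. depolarise \<alpha> \<beta> (x ! j) (y ! j) (u ! j) (v ! j)) / (c * c * (c * c)))"
    unfolding braket_def op_apply_def sum_distrib_left
  proof (intro sum.cong refl)
    fix x y assume xy: "x \<in> bitstrings N" "y \<in> bitstrings N"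
    show "cnj (cluster_state N x) * (\<rho> x y * cluster_state N y) =
      (\<Sum>u\<in>bitstrings N. \<Sum>v\<in>bitstrings N.
      cluster_sign False x * cluster_sign False y * cluster_sign False u * cluster_sign False v *
      (\<Prod>j<N. depolarise \<alpha> \<beta> (x ! j) (y ! j) (u ! j) (v ! j)) / (c * c * (c * c)))"
      unfolding assms[OF xy] depolarised_state_def sum_distrib_left sum_distrib_right
      using xy by (intro sum.cong refl) (simp add: cluster_state_eq c_def mult_ac)
  qed
  also have "\<dots> = chain_sum \<alpha> \<beta> N False False False False / 4 ^ N"
    unfolding c chain_sum_def by (simp only: sum_divide_distrib)
  finally show ?thesis .
qed

section \<open>Transfer recursion for the chain sums\<close>

lemma chain_sum_0: "chain_sum \<alpha> \<beta> 0 p q r t = 1"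
  by (simp add: chain_sum_def bitstrings_0)

text \<open>The first site interacts only with the boundary bits and with the next site, for which
  it becomes the boundary.\<close>

lemma chain_sum_Suc:
  "chain_sum \<alpha> \<beta> (Suc n) p q r t = (\<Sum>x\<in>UNIV. \<Sum>y\<in>UNIV. \<Sum>u\<in>UNIV. \<Sum>v\<in>UNIV.
    (if p \<and> x then - 1 else 1) * (if q \<and> y then - 1 else 1) *
    (if r \<and> u then - 1 else 1) * (if t \<and> v then - 1 else 1) *
    depolarise \<alpha> \<beta> x y u v * chain_sum \<alpha> \<beta> n x y u v)"
proof -
  have swap: "(\<Sum>a\<in>A. \<Sum>x\<in>UNIV. f a x) = (\<Sum>x\<in>UNIV. \<Sum>a\<in>A. f a x)"
    for f :: "bits \<Rightarrow> bool \<Rightarrow> complex" and A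
    by (rule sum.swap)
  show ?thesis
    unfolding chain_sum_def sum_bitstrings_Suc
    unfolding swap sum_distrib_left
    by (intro sum.cong refl)
      (simp only: prod.lessThan_Suc_shift cluster_sign.simps nth_Cons_0 nth_Cons_Suc mult_ac comp_def)
qed

lemma chain_sum_1:
  "chain_sum \<alpha> \<beta> (Suc 0) p q r t =
    4 * (\<alpha> * of_bool (p = r \<and> q = t) + \<beta> * of_bool (p = q \<and> r = t))"
  by (cases p; cases q; cases r; cases t)
    (simp_all add: chain_sum_Suc chain_sum_0 UNIV_bool depolarise_def)

text \<open>The mixed terms in \<open>\<alpha> * \<beta>\<close> force all four bits of a site to
  agree; summing over that common bit leaves only the even-parity condition on the boundary.\<close>

lemma chain_sum_2:
  "chain_sum \<alpha> \<beta> (Suc (Suc 0)) p q r t =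
    16 * (\<alpha>\<^sup>2 * of_bool (p = r \<and> q = t) + \<beta>\<^sup>2 * of_bool (p = q \<and> r = t)
      + \<alpha> * \<beta> * of_bool ((p = q) = (r = t)))"
  by (cases p; cases q; cases r; cases t)
    (simp_all add: chain_sum_Suc[of _ _ "Suc 0"] chain_sum_1 UNIV_bool depolarise_def
      algebra_simps power2_eq_square)

lemma chain_sum_3:
  "chain_sum \<alpha> \<beta> (Suc (Suc (Suc 0))) p q r t =
    64 * (\<alpha>\<^sup>2 * (\<alpha> + \<beta>) * of_bool (p = r \<and> q = t) + \<beta>\<^sup>2 * (\<alpha> + \<beta>) * of_bool (p = q \<and> r = t))
    + 32 * \<alpha> * \<beta> * (\<alpha> + \<beta>) * of_bool ((p = q) = (r = t))"
  by (cases p; cases q; cases r; cases t)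
    (simp_all add: chain_sum_Suc[of _ _ "Suc (Suc 0)"] chain_sum_2 UNIV_bool depolarise_def
      algebra_simps power2_eq_square)

text \<open>No longer chain follows, so only the boundary used by the fidelity is evaluated.\<close>

lemma chain_sum_4:
  "chain_sum \<alpha> \<beta> (Suc (Suc (Suc (Suc 0)))) False False False False =
    256 * (\<alpha>^4 + \<beta>^4) + 512 * (\<alpha>^3 * \<beta> + \<alpha> * \<beta>^3) + 512 * \<alpha>\<^sup>2 * \<beta>\<^sup>2"
  by (simp add: chain_sum_Suc[of _ _ "Suc (Suc (Suc 0))"] chain_sum_3 UNIV_bool depolarise_def
      algebra_simps power2_eq_square power3_eq_cube power4_eq_xxxx)


section \<open>Fidelities\<close>

text \<open>Every \<open>N\<close> other than 3 gets the four-qubit polynomial, so one bound can be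
  stated for all \<open>N\<close>.\<close>

definition fidelity_poly :: "nat \<Rightarrow> real \<Rightarrow> real" where
  "fidelity_poly N l = (if N = 3 then (1 + 3 * l\<^sup>2 + 4 * l^3) / 8
     else (1 + 2 * l\<^sup>2 + 8 * l^3 + 5 * l^4) / 16)"

lemma fidelity_quotient:
  assumes N: "N \<in> {3, 4}" and D: "D = \<alpha> + 2 * \<beta>" "D \<noteq> 0"
  shows "Re (chain_sum (of_real \<alpha>) (of_real \<beta>) N False False False False / 4 ^ N / of_real (D ^ N)) =
    fidelity_poly N (\<alpha> / D)"
proof -
  \<comment> \<open>The chain sum is homogeneous of degree \<open>N\<close>, so dividing by
    \<open>D ^ N\<close> leaves a polynomial in \<open>l\<close> and \<open>\<beta> / D\<close>; the
    latter is \<open>m\<close> because \<open>D = \<alpha> + 2 * \<beta>\<close>.\<close>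
  define l m where "l = \<alpha> / D" and "m = (1 - l) / 2"
  have \<alpha>: "\<alpha> = l * D" and \<beta>: "\<beta> = m * D"
    using D by (auto simp: l_def m_def field_simps)
  consider "N = 3" | "N = 4" using N by auto
  then show ?thesis
  proof cases
    case 1
    have "chain_sum (of_real \<alpha>) (of_real \<beta>) N False False False False =
        complex_of_real (64 * (\<alpha>^3 + \<beta>^3) + 96 * (\<alpha>\<^sup>2 * \<beta> + \<alpha> * \<beta>\<^sup>2))"
      using chain_sum_3[of "of_real \<alpha>" "of_real \<beta>" False False False False] 1
      by (simp add: numeral_3_eq_3[symmetric] algebra_simps power2_eq_square power3_eq_cube)
    then have "Re (chain_sum (of_real \<alpha>) (of_real \<beta>) N False False False False / 4 ^ N / of_real (D ^ N)) =
        Re (complex_of_real ((64 * (\<alpha>^3 + \<beta>^3) + 96 * (\<alpha>\<^sup>2 * \<beta> + \<alpha> * \<beta>\<^sup>2)) / 64 / D ^ 3))"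
      using 1 by simp
    also have "\<dots> = (64 * (\<alpha>^3 + \<beta>^3) + 96 * (\<alpha>\<^sup>2 * \<beta> + \<alpha> * \<beta>\<^sup>2)) / 64 / D ^ 3"
      by (rule Re_complex_of_real)
    also have "\<dots> = l^3 + m^3 + 3/2 * (l\<^sup>2 * m + l * m\<^sup>2)"
      using D(2) unfolding \<alpha> \<beta> by (simp add: field_simps power2_eq_square power3_eq_cube)
    also have "\<dots> = fidelity_poly N l"
      unfolding m_def using 1 by (simp add: fidelity_poly_def field_simps power2_eq_square power3_eq_cube)
    finally show ?thesis by (simp add: l_def)
  next
    case 2
    have "chain_sum (of_real \<alpha>) (of_real \<beta>) N False False False False =
        complex_of_real (256 * (\<alpha>^4 + \<beta>^4) + 512 * (\<alpha>^3 * \<beta> + \<alpha> * \<beta>^3) + 512 * \<alpha>\<^sup>2 * \<beta>\<^sup>2)"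
      using chain_sum_4[of "of_real \<alpha>" "of_real \<beta>"] 2 by (simp add: eval_nat_numeral(2,3))
    then have "Re (chain_sum (of_real \<alpha>) (of_real \<beta>) N False False False False / 4 ^ N / of_real (D ^ N)) =
        Re (complex_of_real ((256 * (\<alpha>^4 + \<beta>^4) + 512 * (\<alpha>^3 * \<beta> + \<alpha> * \<beta>^3) + 512 * \<alpha>\<^sup>2 * \<beta>\<^sup>2) / 256 / D ^ 4))"
      using 2 by simp
    also have "\<dots> = (256 * (\<alpha>^4 + \<beta>^4) + 512 * (\<alpha>^3 * \<beta> + \<alpha> * \<beta>^3) + 512 * \<alpha>\<^sup>2 * \<beta>\<^sup>2) / 256 / D ^ 4"
      by (rule Re_complex_of_real)
    also have "\<dots> = l^4 + m^4 + 2 * (l^3 * m + l * m^3) + 2 * l\<^sup>2 * m\<^sup>2"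
      using D(2) unfolding \<alpha> \<beta> by (simp add: field_simps power2_eq_square power3_eq_cube power4_eq_xxxx)
    also have "\<dots> = fidelity_poly N l"
      unfolding m_def using 2
      by (simp add: fidelity_poly_def field_simps power2_eq_square power3_eq_cube power4_eq_xxxx)
    finally show ?thesis by (simp add: l_def)
  qed
qed

lemma beam_splitter_norm_pos: "1 - 3 * R + 3 * R\<^sup>2 > (0::real)"
proof -
  have "1 - 3 * R + 3 * R\<^sup>2 = 3 * (R - 1/2)\<^sup>2 + 1/4"
    by (simp add: power2_eq_square algebra_simps)
  also have "\<dots> > 0" by (simp add: add_nonneg_pos)
  finally show ?thesis .
qed

lemma fidelity1_cluster:
  assumes "N \<in> {3, 4}"
  shows "fidelity1 N (cluster_state N) R =
    fidelity_poly N ((1 - R) * (1 - 2 * R) / (1 - 3 * R + 3 * R\<^sup>2))"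
proof -
  have num: "braket (bitstrings N) (cluster_state N)
      (op_apply (bitstrings N) (rho1 N R (cluster_state N)) (cluster_state N)) =
    chain_sum (of_real ((1 - R) * (1 - 2 * R))) (of_real (R\<^sup>2 / 2)) N False False False False / 4 ^ N"
    by (intro fidelity_numerator_cluster rho1_eq_depolarised_state)
  show ?thesis
    unfolding fidelity1_def norm_psi_out norm_cluster_state mult_1_right num
    using beam_splitter_norm_pos[of R]
    by (intro fidelity_quotient[OF assms]) (auto simp: power2_eq_square algebra_simps)
qed

lemma fidelity2_cluster:
  assumes "N \<in> {3, 4}"
  shows "fidelity2 N (cluster_state N) R =
    fidelity_poly N (R * (1 - R) / (1 - 3 * R + 3 * R\<^sup>2))"
  unfolding fidelity2_def norm_psi_out norm_cluster_state mult_1_right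
    fidelity_numerator_cluster[OF rho2_eq_depolarised_state]
  using beam_splitter_norm_pos[of R]
  by (intro fidelity_quotient[OF assms]) (auto simp: power2_eq_square field_simps)

text \<open>The threshold \<open>2 / 3\<close> is the common value of both copies' parameters at
  \<open>R = 1 / 3\<close>. For nonnegative \<open>l\<close> the powers are largest at
  \<open>2 / 3\<close>; for negative \<open>l\<close> the cubic term has the helpful sign.\<close>

lemma fidelity_poly_le_half:
  assumes "- 1 \<le> l" "l \<le> 2 / 3"
  shows "fidelity_poly N l \<le> 1 / 2"
proof (cases "0 \<le> l")
  case True
  have "l ^ k \<le> (2 / 3) ^ k" for k
    using True assms by (intro power_mono)
  from this[of 2] this[of 3] this[of 4] show ?thesis
    by (simp add: fidelity_poly_def power2_eq_square power3_eq_cube power4_eq_xxxx)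
next
  case False
  have 2: "l\<^sup>2 \<le> 1"
    using assms False by (simp add: abs_square_le_1)
  have "l ^ 3 \<le> 0"
    using False by (simp add: power_le_zero_eq)
  \<comment> \<open>The cubic term absorbs the quartic one, as \<open>8 + 5 * l\<close> stays
    positive for \<open>l \<ge> - 1\<close>.\<close>
  have "8 * l ^ 3 + 5 * l ^ 4 \<le> 0"
  proof -
    have "8 * l ^ 3 + 5 * l ^ 4 = l ^ 3 * (8 + 5 * l)"
      by (simp add: algebra_simps power3_eq_cube power4_eq_xxxx)
    also have "\<dots> \<le> 0"
      using \<open>l ^ 3 \<le> 0\<close> assms by (intro mult_nonpos_nonneg) auto
    finally show ?thesis .
  qed
  moreover have "3 * l\<^sup>2 + 4 * l ^ 3 \<le> 3 * 1 + 4 * 0"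
    using 2 \<open>l ^ 3 \<le> 0\<close> by (intro add_mono mult_left_mono) auto
  ultimately show ?thesis
    using 2 by (simp add: fidelity_poly_def)
qed

theorem mainTheorem6:
  fixes N :: nat
  assumes "N \<in> {3, 4}"
  shows "\<not> (\<exists>R::real. 0 < R \<and> R < 1 \<and>
           fidelity1 N (cluster_state N) R > 1 / 2 \<and>
           fidelity2 N (cluster_state N) R > 1 / 2)"
proof
  assume "\<exists>R::real. 0 < R \<and> R < 1 \<and>
           fidelity1 N (cluster_state N) R > 1 / 2 \<and>
           fidelity2 N (cluster_state N) R > 1 / 2"
  then obtain R :: real where R: "0 < R" "R < 1"
    and F1: "fidelity1 N (cluster_state N) R > 1 / 2"
    and F2: "fidelity2 N (cluster_state N) R > 1 / 2"
    by blast
  define D where "D = 1 - 3 * R + 3 * R\<^sup>2"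
  have D: "D > 0"
    unfolding D_def by (rule beam_splitter_norm_pos)
  have "- 1 \<le> (1 - R) * (1 - 2 * R) / D"
  proof -
    \<comment> \<open>Completing the square in \<open>2 - 6 * R + 5 * R\<^sup>2\<close>.\<close>
    have "(1 - R) * (1 - 2 * R) + D = 5 * (R - 3/5)\<^sup>2 + 1/5"
      by (simp add: D_def power2_eq_square algebra_simps)
    also have "\<dots> \<ge> 0" by simp
    finally show ?thesis using D by (simp add: field_simps)
  qed
  then have "(1 - R) * (1 - 2 * R) / D > 2 / 3"
    using F1 fidelity_poly_le_half[of "(1 - R) * (1 - 2 * R) / D" N]
    unfolding fidelity1_cluster[OF assms] D_def by linarith
  \<comment> \<open>After multiplying by \<open>3 * D\<close> the quadratic terms cancel.\<close>
  then have "1 - 3 * R > 0"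
    using D by (simp add: field_simps D_def power2_eq_square)
  have "0 \<le> R * (1 - R) / D"
    using R D by simp
  then have "R * (1 - R) / D > 2 / 3"
    using F2 fidelity_poly_le_half[of "R * (1 - R) / D" N]
    unfolding fidelity2_cluster[OF assms] D_def by linarith
  \<comment> \<open>This confines \<open>R\<close> to the interval between \<open>1 / 3\<close> and
    \<open>2 / 3\<close>, against \<open>R < 1 / 3\<close>.\<close>
  then have "(3 * R - 1) * (2 - 3 * R) > 0"
    using D by (simp add: field_simps D_def power2_eq_square)
  then show False
    using \<open>1 - 3 * R > 0\<close> by (simp add: zero_less_mult_iff)
qed

end
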